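(* For every integer $N\ge1$ and every function $f\colon\{\pm1\}^N\to[-1,1]$, $$\mathbb{E}\Big|\sum_{S\neq\emptyset}\widehat f(S)\,x^S\Big|\le 2\,(1-|\widehat f(\emptyset)|),$$ where the sum is over nonempty subsets $S\subset[N]$.
   Context: Here $[N]=\{1,\dots,N\}$; $\mathbb{E}$ denotes the average over $x\in\{\pm1\}^N$, i.e. $\mathbb{E}[g]=2^{-N}\sum_{x\in\{\pm1\}^N}g(x)$. For $f\colon\{\pm1\}^N\to\mathbb{R}$ and $S\subset[N]$ the Fourier coefficient is $\widehat f(S)=\mathbb{E}[f(x)\,x^S]$, with $x^S=\prod_{k\in S}x_k$ and $x^\emptyset=1$, so that $f(x)=\sum_{S\subset[N]}\widehat f(S)x^S$. *)

theory Defs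
  imports Complex_Main "HOL-Library.FuncSet"
begin

text \<open>Points of the cube are functions on \<open>{1..N}\<close>, extended by \<^const>\<open>undefined\<close> elsewhere, so that
  the set below is finite with exactly \<open>2 ^ N\<close> elements.\<close>

definition cube :: "nat \<Rightarrow> (nat \<Rightarrow> real) set" where
  "cube N = {1..N} \<rightarrow>\<^sub>E {-1, 1}"

definition cube_avg :: "nat \<Rightarrow> ((nat \<Rightarrow> real) \<Rightarrow> real) \<Rightarrow> real" where
  "cube_avg N g = (\<Sum>x\<in>cube N. g x) / 2 ^ N"

definition walsh :: "nat set \<Rightarrow> (nat \<Rightarrow> real) \<Rightarrow> real" where
  "walsh S x = (\<Prod>k\<in>S. x k)"

definition fourier_coeff :: "nat \<Rightarrow> ((nat \<Rightarrow> real) \<Rightarrow> real) \<Rightarrow> nat set \<Rightarrow> real" where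
  "fourier_coeff N f S = cube_avg N (\<lambda>x. f x * walsh S x)"

end

theory Submission imports Defs begin

text \<open>By Fourier inversion, the sum over nonempty \<open>S\<close> is \<open>f - \<mu>\<close>, where \<open>\<mu>\<close> is the mean of \<open>f\<close>
  (lemma \<open>walsh_expansion\<close>), so the claim bounds the mean absolute deviation of \<open>f\<close>. After a sign
  change one may take \<open>\<mu> \<ge> 0\<close>. The function \<open>1 - f\<close> is then nonnegative with mean \<open>1 - \<mu>\<close>, and
  the triangle inequality \<open>\<bar>f - \<mu>\<bar> \<le> (1 - f) + (1 - \<mu>)\<close> averages to \<open>2 * (1 - \<mu>)\<close>.\<close>

lemma finite_cube: "finite (cube N)"
  unfolding cube_def by (intro finite_PiE) auto

lemma card_cube: "card (cube N) = 2 ^ N"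
  unfolding cube_def by (simp add: card_PiE numeral_2_eq_2)

lemma cube_avg_const: "cube_avg N (\<lambda>x. c) = c"
  by (simp add: cube_avg_def card_cube)

lemma cube_avg_add: "cube_avg N (\<lambda>x. g x + h x) = cube_avg N g + cube_avg N h"
  by (simp add: cube_avg_def sum.distrib add_divide_distrib)

lemma cube_avg_cmult: "cube_avg N (\<lambda>x. c * g x) = c * cube_avg N g"
  by (simp add: cube_avg_def sum_distrib_left)

lemma cube_avg_mono:
  assumes "\<And>x. x \<in> cube N \<Longrightarrow> g x \<le> h x"
  shows "cube_avg N g \<le> cube_avg N h"
  unfolding cube_avg_def by (intro divide_right_mono sum_mono assms) auto

lemma fourier_coeff_empty: "fourier_coeff N f {} = cube_avg N f"
  by (simp add: fourier_coeff_def walsh_def)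

text \<open>The sum factors as \<open>\<Prod>k. 1 + y k * x k\<close>; each factor is \<open>2\<close> where \<open>x\<close> and \<open>y\<close> agree and
  \<open>0\<close> where they differ.\<close>

lemma walsh_kernel:
  assumes x: "x \<in> cube N" and y: "y \<in> cube N"
  shows "(\<Sum>S\<in>Pow {1..N}. walsh S y * walsh S x) = (if y = x then 2 ^ N else 0)"
proof -
  have val: "x k = 1 \<or> x k = -1" "y k = 1 \<or> y k = -1" if "k \<in> {1..N}" for k
    using x y that unfolding cube_def by (auto dest: PiE_mem)
  have "(\<Sum>S\<in>Pow {1..N}. walsh S y * walsh S x) = (\<Prod>k\<in>{1..N}. y k * x k + 1)"
    by (simp add: prod_add walsh_def prod.distrib)
  also have "\<dots> = (if y = x then 2 ^ N else 0)"
  proof (cases "y = x")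
    case True
    have "(\<Prod>k\<in>{1..N}. y k * x k + 1) = (\<Prod>k\<in>{1..N}. 2)"
      by (rule prod.cong) (use val True in force)+
    with True show ?thesis by simp
  next
    case False
    then obtain k where k: "k \<in> {1..N}" "y k \<noteq> x k"
      using x y unfolding cube_def by (meson PiE_ext)
    then have "y k * x k + 1 = 0" using val[of k] by auto
    with k False show ?thesis by (auto intro: prod_zero)
  qed
  finally show ?thesis .
qed

lemma walsh_expansion:
  assumes x: "x \<in> cube N"
  shows "(\<Sum>S\<in>Pow {1..N}. fourier_coeff N f S * walsh S x) = f x"
proof -
  have "(\<Sum>S\<in>Pow {1..N}. fourier_coeff N f S * walsh S x)
      = (\<Sum>S\<in>Pow {1..N}. \<Sum>y\<in>cube N. f y * (walsh S y * walsh S x)) / 2 ^ N"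
    by (simp add: fourier_coeff_def cube_avg_def sum_distrib_right sum_divide_distrib mult.assoc)
  also have "\<dots> = (\<Sum>y\<in>cube N. f y * (\<Sum>S\<in>Pow {1..N}. walsh S y * walsh S x)) / 2 ^ N"
    by (subst sum.swap) (simp add: sum_distrib_left)
  also have "\<dots> = (\<Sum>y\<in>cube N. if y = x then f y * 2 ^ N else 0) / 2 ^ N"
    using x by (intro arg_cong2[of _ _ _ _ "(/)"] sum.cong) (auto simp: walsh_kernel simp del: One_nat_def)
  also have "\<dots> = f x"
    using x by (simp add: finite_cube)
  finally show ?thesis .
qed

theorem corollary4p3:
  fixes N :: nat and f :: "(nat \<Rightarrow> real) \<Rightarrow> real"
  assumes "N \<ge> 1"
    and "f \<in> cube N \<rightarrow> {-1..1}"
  shows "cube_avg N (\<lambda>x. \<bar>\<Sum>S\<in>Pow {1..N} - {{}}. fourier_coeff N f S * walsh S x\<bar>)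
           \<le> 2 * (1 - \<bar>fourier_coeff N f {}\<bar>)"
proof -
  define \<mu> where "\<mu> = cube_avg N f"
  \<comment> \<open>Unlike \<open>sgn \<mu>\<close>, this sign is nonzero when \<open>\<mu> = 0\<close>, so that \<open>\<bar>s\<bar> = 1\<close> always.\<close>
  define s where "s = (if \<mu> \<ge> 0 then 1 else - 1 :: real)"
  have s: "s * \<mu> = \<bar>\<mu>\<bar>" by (simp add: s_def)
  have bound: "\<bar>f x\<bar> \<le> 1" if "x \<in> cube N" for x
    using assms(2) that by (auto simp: abs_le_iff Pi_iff)
  have "\<bar>\<mu>\<bar> \<le> 1"
  proof -
    have "s * \<mu> = cube_avg N (\<lambda>x. s * f x)" by (simp add: \<mu>_def cube_avg_cmult)
    also have "\<dots> \<le> cube_avg N (\<lambda>x. 1)"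
      using bound by (intro cube_avg_mono) (force simp: s_def abs_le_iff)
    finally show ?thesis by (simp add: s cube_avg_const)
  qed
  have dev: "(\<Sum>S\<in>Pow {1..N} - {{}}. fourier_coeff N f S * walsh S x) = f x - \<mu>"
    if "x \<in> cube N" for x
    using walsh_expansion[OF that, of f]
    by (simp add: sum_diff1 fourier_coeff_empty \<mu>_def walsh_def)
  have "cube_avg N (\<lambda>x. \<bar>\<Sum>S\<in>Pow {1..N} - {{}}. fourier_coeff N f S * walsh S x\<bar>)
      \<le> cube_avg N (\<lambda>x. (2 - \<bar>\<mu>\<bar>) + (- s) * f x)"
  proof (rule cube_avg_mono)
    fix x assume x: "x \<in> cube N"
    show "\<bar>\<Sum>S\<in>Pow {1..N} - {{}}. fourier_coeff N f S * walsh S x\<bar>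
        \<le> (2 - \<bar>\<mu>\<bar>) + (- s) * f x"
      unfolding dev[OF x] using bound[OF x] \<open>\<bar>\<mu>\<bar> \<le> 1\<close> by (auto simp: s_def)
  qed
  also have "\<dots> = (2 - \<bar>\<mu>\<bar>) - s * \<mu>"
    by (simp only: cube_avg_add cube_avg_cmult cube_avg_const \<mu>_def)
  also have "\<dots> = 2 * (1 - \<bar>\<mu>\<bar>)"
    by (simp add: s)
  finally show ?thesis by (simp add: fourier_coeff_empty \<mu>_def)
qed

end
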